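(* Let $G$ be a finite abelian group and let $\Gamma=\operatorname{Cay}(G,S)$ be a strongly connected Cayley digraph of out-degree $d=|S|$ and order $n=|G|$. For every proper subgroup $K<G$, define $$ r_K:=\left|\left\{\{\bar g,-\bar g\}: g\in S,\ \bar g\ne 0\text{ in }G/K\right\}\right|, \qquad N_K:=\left\lfloor\left(|G/K|-1\right)^{1/r_K}\right\rfloor, $$ where $\bar g:=g+K$, and let $N_*:=\max_{K<G}N_K$, the maximum being over all proper subgroups $K$ of $G$. Then, for every integer $s\ge 1$, $$ c_{1,s}(\Gamma)\le c_{1,\infty}(\Gamma)\le \min\left\{\frac{n\left(1+\log(d+1)\right)}{d+1},\ \frac{2n}{N_*}\right\}. $$
   Context: Cayley digraphs: $G$ is a nontrivial finite abelian group written additively ($|G|\ge 2$), $S\subseteq G\setminus\{0\}$, and $\operatorname{Cay}(G,S)$ is the digraph with vertex set $G$ and an arc $x\to x+g$ for every $x\in G$, $g\in S$. It is strongly connected if and only if $S$ generates $G$. Logarithms are natural. The game on a finite digraph $\Gamma$ with speed-$1$ cops and a speed-$s$ robber: the cops choose their initial vertices first, then the robber chooses its initial vertex. Thereafter players alternate, the cops moving first in each round. On the cops' move each cop may remain where it is or move along one arc. On the robber's move, the robber may remain where it is or move along a directed path of length at most $s$ no vertex of which (including the terminal vertex) is occupied by a cop. A directed path is a vertex sequence without repetition whose consecutive vertices are joined by arcs in the forward direction; its length is its number of arcs. Capture occurs as soon as a cop and the robber occupy the same vertex. $c_{1,s}(\Gamma)$ is the least number of speed-$1$ cops that guarantee capture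 of a speed-$s$ robber. $c_{1,\infty}(\Gamma)$ is the corresponding number when the robber may traverse any finite cop-free directed path (of arbitrary length) in one turn. *)

theory Defs
  imports
    Complex_Main
    "HOL-Library.Extended_Nat"
    "HOL-Algebra.Coset"
    "Graph_Theory.Digraph_Component"
    "Graph_Theory.Vertex_Walk"
begin

section \<open>Cayley digraphs and the invariants of proper subgroups\<close>

definition cayley_digraph :: "('a, 'm) monoid_scheme \<Rightarrow> 'a set \<Rightarrow> 'a pair_pre_digraph" where
  "cayley_digraph G S =
     \<lparr>pverts = carrier G, parcs = {(x, x \<otimes>\<^bsub>G\<^esub> g) | x g. x \<in> carrier G \<and> g \<in> S}\<rparr>"

definition num_directions :: "('a, 'm) monoid_scheme \<Rightarrow> 'a set \<Rightarrow> 'a set \<Rightarrow> nat" where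
  "num_directions G S K =
     card {{K #>\<^bsub>G\<^esub> g, inv\<^bsub>G Mod K\<^esub> (K #>\<^bsub>G\<^esub> g)} | g. g \<in> S \<and> K #>\<^bsub>G\<^esub> g \<noteq> \<one>\<^bsub>G Mod K\<^esub>}"

definition root_index :: "('a, 'm) monoid_scheme \<Rightarrow> 'a set \<Rightarrow> 'a set \<Rightarrow> nat" where
  "root_index G S K =
     nat \<lfloor>(real (order (G Mod K)) - 1) powr (1 / real (num_directions G S K))\<rfloor>"

definition max_root_index :: "('a, 'm) monoid_scheme \<Rightarrow> 'a set \<Rightarrow> nat" where
  "max_root_index G S = Max {root_index G S K | K. subgroup K G \<and> K \<subset> carrier G}"

section \<open>Cops and a fast robber on a digraph\<close>

definition cop_move :: "('a, 'b) pre_digraph \<Rightarrow> 'a \<Rightarrow> 'a \<Rightarrow> bool" where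
  "cop_move \<Gamma> x y \<longleftrightarrow> y = x \<or> x \<rightarrow>\<^bsub>\<Gamma>\<^esub> y"

text \<open>
  The argument \<open>X\<close> is the set of vertices occupied by cops; the speed \<open>s\<close> may be \<open>\<infinity>\<close>.
  Remaining in place is the path with a single vertex.
\<close>

definition robber_move :: "('a, 'b) pre_digraph \<Rightarrow> enat \<Rightarrow> 'a set \<Rightarrow> 'a \<Rightarrow> 'a \<Rightarrow> bool" where
  "robber_move \<Gamma> s X u v \<longleftrightarrow>
     (\<exists>p. vpath p \<Gamma> \<and> hd p = u \<and> last p = v \<and> enat (vwalk_length p) \<le> s \<and> set p \<inter> X = {})"

text \<open>
  A strategy for \<open>k\<close> cops maps the list of the robber's positions so far, oldest first, to the
  cops' next positions: \<open>\<sigma> []\<close> is the initial placement, chosen before the robber's, and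
  \<open>\<sigma> [r\<^sub>0, \<dots>, r\<^sub>t]\<close> is the placement after the cops' move in round \<open>t + 1\<close>. The cops' own earlier
  positions need not be recorded, as \<open>\<sigma>\<close> determines them.
\<close>

definition cop_strategy :: "('a, 'b) pre_digraph \<Rightarrow> nat \<Rightarrow> ('a list \<Rightarrow> nat \<Rightarrow> 'a) \<Rightarrow> bool" where
  "cop_strategy \<Gamma> k \<sigma> \<longleftrightarrow>
     (\<forall>i<k. \<sigma> [] i \<in> verts \<Gamma>) \<and>
     (\<forall>h v. set h \<subseteq> verts \<Gamma> \<longrightarrow> v \<in> verts \<Gamma> \<longrightarrow> (\<forall>i<k. cop_move \<Gamma> (\<sigma> h i) (\<sigma> (h @ [v]) i)))"

text \<open>
  An uncaptured robber can always remain in place, so a play stops only by capture; the robber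
  escapes exactly if the play goes on forever. Capture can occur at the initial placement or
  by a cops' move; the robber's own moves avoid the cops.
\<close>

definition escapes ::
  "('a, 'b) pre_digraph \<Rightarrow> enat \<Rightarrow> nat \<Rightarrow> ('a list \<Rightarrow> nat \<Rightarrow> 'a) \<Rightarrow> (nat \<Rightarrow> 'a) \<Rightarrow> bool" where
  "escapes \<Gamma> s k \<sigma> r \<longleftrightarrow>
     r 0 \<in> verts \<Gamma> \<and> r 0 \<notin> \<sigma> [] ` {..<k} \<and>
     (\<forall>t. let X = \<sigma> (map r [0..<Suc t]) ` {..<k}
          in r t \<notin> X \<and> robber_move \<Gamma> s X (r t) (r (Suc t)))"

definition cops_win :: "('a, 'b) pre_digraph \<Rightarrow> enat \<Rightarrow> nat \<Rightarrow> bool" where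
  "cops_win \<Gamma> s k \<longleftrightarrow> (\<exists>\<sigma>. cop_strategy \<Gamma> k \<sigma> \<and> (\<forall>r. \<not> escapes \<Gamma> s k \<sigma> r))"

definition cop_number :: "('a, 'b) pre_digraph \<Rightarrow> enat \<Rightarrow> nat" where
  "cop_number \<Gamma> s = (LEAST k. cops_win \<Gamma> s k)"

end

(*
  For the first bound, the cops start on a dominating set and capture the robber in one move; a
  greedy choice gives such a set of size at most n H(d+1) / (d+1), with H the harmonic numbers.

  For the second, fix a proper subgroup K. There are at least |G/K| homomorphisms G -> Z/n trivial on
  K, so by the pigeonhole principle some nontrivial one sends every generator to within less than
  n / N_K of 0. It maps the digraph to a circle on which every arc makes a short step. Two blocks of
  cops, each as wide as the longest step, then confine the robber to an arc of the circle: one block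
  stands still while the other, translated by a generator that moves on the circle, sweeps around to
  it. Averaging over the rotations of the circle bounds the number of cops by 2n / N_K.
*)
theory Submission
  imports Defs "HOL-Analysis.Harmonic_Numbers" "HOL-Algebra.Multiplicative_Group" "HOL-Number_Theory.Cong"
begin

section \<open>Greedy covers\<close>

text \<open>Every term added between \<open>harm b\<close> and \<open>harm a\<close> has index at
  most \<open>m\<close>, so it contributes at least 1/m.\<close>

lemma harm_ge_add_diff:
  assumes "b \<le> a" and "a \<le> m" and "m > 0"
  shows "harm b + (real a - real b) / real m \<le> harm a"
  using assms
proof (induction a rule: dec_induct)
  case (step a)
  have "1 / real m \<le> inverse (real (Suc a))"
    using step.prems by (auto simp: field_simps)
  with step show ?case
    by (simp add: harm_Suc add_divide_distrib diff_divide_distrib)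
qed simp

text \<open>The sequence \<open>harm n - ln n\<close> decreases from its value 1 at n = 1.\<close>

lemma harm_le_one_plus_ln:
  assumes "n > 0"
  shows "harm n \<le> 1 + ln (real n)"
  using euler_mascheroni_sequence_decreasing[of 1 n] assms by (simp add: harm_expand)

text \<open>
  The right-hand side of the bound is a potential: a greedy choice covering \<open>m\<close> new points lowers it
  by at least \<open>q\<close>, since every set meets the uncovered part in at most \<open>m\<close> points and so loses
  at least \<open>1/m\<close> for each newly covered point.
\<close>

lemma greedy_cover:
  fixes N :: "'a \<Rightarrow> 'b set"
  assumes "finite V" and "finite U" and "q > 0"
    and "\<And>u. u \<in> U \<Longrightarrow> q \<le> card {w \<in> V. u \<in> N w}"
  shows "\<exists>D\<subseteq>V. U \<subseteq> \<Union>(N ` D) \<and> real q * real (card D) \<le> (\<Sum>w\<in>V. harm (card (N w \<inter> U)))"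
  using assms(2,4)
proof (induction "card U" arbitrary: U rule: less_induct)
  case less
  show ?case
  proof (cases "U = {}")
    case True
    then show ?thesis by (intro exI[of _ "{}"]) (auto simp: sum_nonneg harm_nonneg)
  next
    case False
    then obtain u where u: "u \<in> U" by blast
    with less.prems(2)[of u] assms(3) have "card {w \<in> V. u \<in> N w} \<noteq> 0" by auto
    then have "{w \<in> V. u \<in> N w} \<noteq> {}" by (metis card.empty)
    then obtain w1 where w1: "w1 \<in> V" "u \<in> N w1" by blast
    define f where "f w = card (N w \<inter> U)" for w
    obtain w0 where w0: "w0 \<in> V" "\<And>w. w \<in> V \<Longrightarrow> f w \<le> f w0"
    proof -
      have "finite (f ` V)" "f ` V \<noteq> {}" using assms(1) w1 by auto
      then have "Max (f ` V) \<in> f ` V" by (rule Max_in)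
      then obtain w0 where "w0 \<in> V" "f w0 = Max (f ` V)" by force
      then show thesis using that[of w0] assms(1) by simp
    qed
    define m where "m = f w0"
    have "f w1 > 0" unfolding f_def using w1 u less.prems(1) by (auto simp: card_gt_0_iff)
    then have m: "m > 0" using w0(2)[OF w1(1)] by (simp add: m_def)
    define W where "W = N w0 \<inter> U"
    have W: "finite W" "card W = m" "W \<subseteq> U" using less.prems(1) by (auto simp: W_def m_def f_def)
    define U' where "U' = U - W"
    have "card U' < card U" unfolding U'_def using W m less.prems(1)
      by (metis Diff_subset card_gt_0_iff card_mono card_Diff_subset diff_less le_trans less_le_trans)
    moreover have "finite U'" using less.prems(1) by (simp add: U'_def)
    moreover have "\<And>u. u \<in> U' \<Longrightarrow> q \<le> card {w \<in> V. u \<in> N w}" using less.prems(2) by (auto simp: U'_def)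
    ultimately obtain D where D: "D \<subseteq> V" "U' \<subseteq> \<Union>(N ` D)"
      "real q * real (card D) \<le> (\<Sum>w\<in>V. harm (card (N w \<inter> U')))"
      using less.hyps[of U'] by blast
    have drop: "harm (card (N w \<inter> U')) + real (card (N w \<inter> W)) / real m \<le> harm (card (N w \<inter> U))"
      if "w \<in> V" for w
    proof -
      have "N w \<inter> U = (N w \<inter> U') \<union> (N w \<inter> W)" "(N w \<inter> U') \<inter> (N w \<inter> W) = {}"
        using W(3) by (auto simp: U'_def)
      then have "card (N w \<inter> U) = card (N w \<inter> U') + card (N w \<inter> W)"
        using \<open>finite U'\<close> W(1) by (simp add: card_Un_disjoint)
      moreover have "card (N w \<inter> U) \<le> m" using w0(2)[OF that] by (simp add: m_def f_def)
      ultimately show ?thesis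
        using harm_ge_add_diff[of "card (N w \<inter> U')" "card (N w \<inter> U)" m] m by simp
    qed
    \<comment> \<open>Double counting: each of the \<open>m\<close> points of \<open>W\<close> lies
      in at least \<open>q\<close> sets. Counting the incidences by sets and dividing by
      \<open>m\<close>, the total drop is at least \<open>q\<close>, the price of adding
      \<open>w0\<close>.\<close>
    have "real q * real m \<le> (\<Sum>u\<in>W. real (card {w \<in> V. u \<in> N w}))"
      using sum_mono[of W "\<lambda>_. real q" "\<lambda>u. real (card {w \<in> V. u \<in> N w})"] less.prems(2) W
      by (auto simp: mult.commute)
    also have "\<dots> = (\<Sum>u\<in>W. \<Sum>w\<in>V. if u \<in> N w then 1 else 0)"
      using assms(1) by (simp add: sum.If_cases Int_def)
    also have "\<dots> = (\<Sum>w\<in>V. \<Sum>u\<in>W. if u \<in> N w then 1 else 0)" by (rule sum.swap)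
    also have "\<dots> = (\<Sum>w\<in>V. real (card (N w \<inter> W)))"
      using W(1) by (simp add: sum.If_cases Int_def conj_commute)
    finally have "real q \<le> (\<Sum>w\<in>V. real (card (N w \<inter> W)) / real m)"
      using m by (simp add: sum_divide_distrib[symmetric] field_simps)
    moreover have "(\<Sum>w\<in>V. harm (card (N w \<inter> U'))) + (\<Sum>w\<in>V. real (card (N w \<inter> W)) / real m)
        \<le> (\<Sum>w\<in>V. harm (card (N w \<inter> U)))"
      unfolding sum.distrib[symmetric] by (rule sum_mono) (rule drop)
    ultimately have *: "real q * (real (card D) + 1) \<le> (\<Sum>w\<in>V. harm (card (N w \<inter> U)))"
      using D(3) by (simp add: algebra_simps)
    have "finite D" using D(1) assms(1) finite_subset by blast
    then have "real (card (insert w0 D)) \<le> real (card D) + 1" by (simp add: card_insert_if)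
    then have "real q * real (card (insert w0 D)) \<le> real q * (real (card D) + 1)"
      by (intro mult_left_mono) auto
    with * have "real q * real (card (insert w0 D)) \<le> (\<Sum>w\<in>V. harm (card (N w \<inter> U)))" by linarith
    moreover have "U \<subseteq> \<Union>(N ` insert w0 D)" using D(2) by (auto simp: U'_def W_def)
    ultimately show ?thesis using D(1) w0(1) by (intro exI[of _ "insert w0 D"]) auto
  qed
qed

section \<open>Strategies for the cops\<close>

lemma parcs_cayley_iff:
  "(u, v) \<in> parcs (cayley_digraph G S) \<longleftrightarrow> u \<in> carrier G \<and> (\<exists>g\<in>S. v = u \<otimes>\<^bsub>G\<^esub> g)"
  by (auto simp: cayley_digraph_def)

lemma pverts_cayley [simp]: "pverts (cayley_digraph G S) = carrier G"
  by (simp add: cayley_digraph_def)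

section \<open>Comparison of robber speeds and capture from a dominating set\<close>

lemma robber_move_mono:
  assumes "robber_move \<Gamma> s X u v" and "s \<le> s'"
  shows "robber_move \<Gamma> s' X u v"
proof -
  obtain p where "vpath p \<Gamma>" "hd p = u" "last p = v" "set p \<inter> X = {}" "enat (vwalk_length p) \<le> s"
    using assms(1) unfolding robber_move_def by blast
  moreover from this(5) have "enat (vwalk_length p) \<le> s'" using assms(2) by (rule order_trans)
  ultimately show ?thesis unfolding robber_move_def by blast
qed

text \<open>An escape at the lower speed is also an escape at the higher one against the same
  strategy, so a winning strategy carries over unchanged.\<close>

lemma cops_win_antimono_speed:
  assumes "cops_win \<Gamma> s' k" and "s \<le> s'"
  shows "cops_win \<Gamma> s k"
proof -
  have "escapes \<Gamma> s' k \<sigma> r" if "escapes \<Gamma> s k \<sigma> r" for \<sigma> r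
    using that unfolding escapes_def Let_def by (auto intro: robber_move_mono[OF _ assms(2)])
  with assms(1) show ?thesis unfolding cops_win_def by blast
qed

lemma cop_number_le: "cops_win \<Gamma> s k \<Longrightarrow> cop_number \<Gamma> s \<le> k"
  unfolding cop_number_def by (rule Least_le)

lemma cops_win_dominating:
  assumes "finite D" and "D \<subseteq> verts \<Gamma>"
    and dom: "\<And>v. v \<in> verts \<Gamma> \<Longrightarrow> \<exists>w\<in>D. cop_move \<Gamma> w v"
  shows "cops_win \<Gamma> s (card D)"
proof -
  obtain k c where k: "k = card D" and c: "bij_betw c {..<k} D"
    using assms(1) bij_betw_from_nat_into_finite by blast
  \<comment> \<open>\<open>hd h\<close> is the robber's initial vertex. A cop that can reach it does
    so in the first round and then stays; the other cops never move.\<close>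
  define \<sigma> where "\<sigma> h i = (if h \<noteq> [] \<and> cop_move \<Gamma> (c i) (hd h) then hd h else c i)" for h i
  have cD: "c i \<in> D" if "i < k" for i
    using c that by (auto simp: bij_betw_def)
  have "cop_strategy \<Gamma> k \<sigma>"
    using cD assms(2) unfolding cop_strategy_def
    by (auto simp: \<sigma>_def hd_append cop_move_def)
  moreover have "\<not> escapes \<Gamma> s k \<sigma> r" for r
  proof
    assume esc: "escapes \<Gamma> s k \<sigma> r"
    then obtain w where w: "w \<in> D" "cop_move \<Gamma> w (r 0)"
      using dom unfolding escapes_def by blast
    moreover have "c ` {..<k} = D" using c by (rule bij_betw_imp_surj_on)
    ultimately obtain i where "i < k" "c i = w" by blast
    then have "r 0 \<in> \<sigma> (map r [0..<Suc 0]) ` {..<k}"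
      using w by (auto simp: \<sigma>_def image_iff intro!: bexI[of _ i])
    then show False using esc unfolding escapes_def Let_def by blast
  qed
  ultimately show ?thesis unfolding cops_win_def k[symmetric] by blast
qed

text \<open>The path is followed arc by arc, so an invariant of single arcs into cop-free vertices
  survives a move of any length. This makes confinement independent of the speed.\<close>

lemma robber_move_induct:
  assumes move: "robber_move \<Gamma> s X u v" and "P u"
    and step: "\<And>x y. x \<rightarrow>\<^bsub>\<Gamma>\<^esub> y \<Longrightarrow> P x \<Longrightarrow> y \<notin> X \<Longrightarrow> P y"
  shows "P v"
proof -
  obtain p where p: "vwalk p \<Gamma>" "hd p = u" "last p = v" "set p \<inter> X = {}"
    using move unfolding robber_move_def vpath_def by blast
  have "P (hd p) \<Longrightarrow> set p \<inter> X = {} \<Longrightarrow> P (last p)"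
    using p(1)
  proof (induction rule: vwalk_induct)
    case (Cons x y es)
    have "P x" "y \<notin> X" using Cons(3,4) by auto
    then have "P y" by (rule step[OF Cons(1)])
    then have "P (last (y # es))" using Cons(2,4) by simp
    then show ?case by simp
  qed simp
  with p assms(2) show ?thesis by simp
qed

lemma (in group) subgroup_nat_pow_closed:
  assumes "subgroup H G" and "x \<in> H"
  shows "x [^] (j::nat) \<in> H"
  using assms by (induction j) (simp_all add: subgroup.one_closed subgroup.m_closed)

lemma (in group) hom_mod_nat_pow:
  assumes H: "subgroup H G"
    and hom: "\<And>x y. x \<in> H \<Longrightarrow> y \<in> H \<Longrightarrow> [\<psi> (x \<otimes> y) = \<psi> x + \<psi> y] (mod e)"
    and x: "x \<in> H"
  shows "[\<psi> (x [^] (j::nat)) = int j * \<psi> x] (mod (e::int))"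
proof (induction j)
  case 0
  have "[\<psi> \<one> + \<psi> \<one> = \<psi> \<one> + 0] (mod e)"
    using hom[of \<one> \<one>] subgroup.one_closed[OF H] by (simp add: cong_sym)
  then show ?case by (simp only: cong_add_lcancel) simp
next
  case (Suc j)
  have "[\<psi> (x [^] j \<otimes> x) = \<psi> (x [^] j) + \<psi> x] (mod e)"
    using hom subgroup_nat_pow_closed[OF H x] x by simp
  also have "[\<psi> (x [^] j) + \<psi> x = int j * \<psi> x + \<psi> x] (mod e)"
    using Suc by (rule cong_add) simp
  finally show ?case by (simp add: algebra_simps)
qed

text \<open>Averaging over the \<open>e\<close> rotations: the offsets of a fixed point are distinct
  for distinct \<open>a\<close>, so it lies in at most \<open>w\<close> of the windows, and some
  window holds no more than the average.\<close>

lemma exists_light_window: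
  fixes \<psi> :: "'a \<Rightarrow> int" and e :: int and w :: nat
  assumes "finite V" and "0 < e"
  shows "\<exists>a. int (card {x \<in> V. (\<psi> x - a) mod e < int w}) * e \<le> int w * int (card V)"
proof (rule ccontr)
  define C where "C a = {x \<in> V. (\<psi> x - a) mod e < int w}" for a
  assume "\<not> ?thesis"
  then have "int w * int (card V) < int (card (C a)) * e" for a
    by (auto simp: C_def not_le)
  then have "(\<Sum>a\<in>{0..<e}. int w * int (card V)) < (\<Sum>a\<in>{0..<e}. int (card (C a)) * e)"
    using assms(2) by (intro sum_strict_mono) auto
  also have "\<dots> = (\<Sum>a\<in>{0..<e}. int (card (C a))) * e"
    by (simp add: sum_distrib_right)
  also have "(\<Sum>a\<in>{0..<e}. int (card (C a)))
      = (\<Sum>a\<in>{0..<e}. \<Sum>x\<in>V. if (\<psi> x - a) mod e < int w then 1 else 0)"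
    using assms(1) by (simp add: C_def sum.If_cases Int_def)
  also have "\<dots> = (\<Sum>x\<in>V. \<Sum>a\<in>{0..<e}. if (\<psi> x - a) mod e < int w then 1 else 0)"
    by (rule sum.swap)
  also have "\<dots> = (\<Sum>x\<in>V. int (card {a \<in> {0..<e}. (\<psi> x - a) mod e < int w}))"
    by (simp add: sum.If_cases Int_def)
  also have "\<dots> \<le> (\<Sum>x\<in>V. int w)"
  proof (rule sum_mono)
    fix x
    have "inj_on (\<lambda>a. (\<psi> x - a) mod e) {a \<in> {0..<e}. (\<psi> x - a) mod e < int w}"
    proof (rule inj_onI)
      fix a b assume "a \<in> {a \<in> {0..<e}. (\<psi> x - a) mod e < int w}"
        "b \<in> {a \<in> {0..<e}. (\<psi> x - a) mod e < int w}" "(\<psi> x - a) mod e = (\<psi> x - b) mod e"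
      then have "[a = b] (mod e)" "0 \<le> a" "a < e" "0 \<le> b" "b < e"
        by (auto simp: cong_iff_dvd_diff mod_eq_dvd_iff dvd_diff_commute)
      then show "a = b" by (simp add: cong_def)
    qed
    moreover have "(\<lambda>a. (\<psi> x - a) mod e) ` {a \<in> {0..<e}. (\<psi> x - a) mod e < int w} \<subseteq> {0..<int w}"
      using assms(2) by auto
    ultimately have "card {a \<in> {0..<e}. (\<psi> x - a) mod e < int w} \<le> card {0..<int w}"
      by (rule card_inj_on_le) simp
    then show "int (card {a \<in> {0..<e}. (\<psi> x - a) mod e < int w}) \<le> int w" by simp
  qed
  finally show False using assms(2) by (simp add: algebra_simps)
qed

text \<open>The sets of the cover are the closed out-neighbourhoods. A vertex u lies in those of u -
  g for g in \<open>S\<close> or g = 0, so \<open>greedy_cover\<close> applies with q = d + 1, and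
  each term of its potential is at most H(d+1).\<close>

lemma (in comm_group) exists_dominating_set:
  assumes fin: "finite (carrier G)" and S: "S \<subseteq> carrier G - {\<one>}"
  obtains D where "D \<subseteq> carrier G"
    and "\<And>v. v \<in> carrier G \<Longrightarrow> \<exists>w\<in>D. cop_move (with_proj (cayley_digraph G S)) w v"
    and "real (card S + 1) * real (card D) \<le> real (order G) * (1 + ln (real (card S + 1)))"
proof -
  define B where "B = insert \<one> S"
  have finS: "finite S" using S fin finite_subset[of S "carrier G"] by blast
  have "\<one> \<notin> S" using S by blast
  then have BG: "B \<subseteq> carrier G" and cardB: "card B = card S + 1" and finB: "finite B"
    using S finS by (auto simp: B_def)
  define N where "N w = (\<lambda>g. w \<otimes> g) ` B" for w
  have "card B \<le> card {w \<in> carrier G. u \<in> N w}" if u: "u \<in> carrier G" for u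
  proof (rule card_inj_on_le[of "\<lambda>g. u \<otimes> inv g"])
    show "inj_on (\<lambda>g. u \<otimes> inv g) B"
    proof (rule inj_onI)
      fix a b assume ab: "a \<in> B" "b \<in> B" "u \<otimes> inv a = u \<otimes> inv b"
      then have "inv a = inv b" using u BG by (simp add: subset_iff)
      then have "inv (inv a) = inv (inv b)" by simp
      then show "a = b" using ab BG by (simp add: subset_iff)
    qed
    show "(\<lambda>g. u \<otimes> inv g) ` B \<subseteq> {w \<in> carrier G. u \<in> N w}"
    proof clarify
      fix g assume g: "g \<in> B"
      then have "u = (u \<otimes> inv g) \<otimes> g" using u BG by (auto simp: m_assoc)
      then show "u \<otimes> inv g \<in> carrier G \<and> u \<in> N (u \<otimes> inv g)"
        using g u BG unfolding N_def by blast
    qed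
  qed (use fin in simp)
  then obtain D where D: "D \<subseteq> carrier G" "carrier G \<subseteq> \<Union>(N ` D)"
    "real (card B) * real (card D) \<le> (\<Sum>w\<in>carrier G. harm (card (N w \<inter> carrier G)))"
    using greedy_cover[OF fin fin, of "card B" N] cardB by auto
  have "(\<Sum>w\<in>carrier G. harm (card (N w \<inter> carrier G))) \<le> (\<Sum>w\<in>carrier G. 1 + ln (real (card B)))"
  proof (rule sum_mono)
    fix w
    have "card (N w \<inter> carrier G) \<le> card (N w)" using finB by (intro card_mono) (auto simp: N_def)
    also have "\<dots> \<le> card B" unfolding N_def using finB by (rule card_image_le)
    finally have "harm (card (N w \<inter> carrier G)) \<le> (harm (card B) :: real)" by (rule harm_mono)
    also have "\<dots> \<le> 1 + ln (real (card B))" using cardB by (intro harm_le_one_plus_ln) simp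
    finally show "harm (card (N w \<inter> carrier G)) \<le> 1 + ln (real (card B))" .
  qed
  with D(3) have "real (card S + 1) * real (card D) \<le> real (order G) * (1 + ln (real (card S + 1)))"
    by (simp add: order_def cardB)
  moreover have "\<exists>w\<in>D. cop_move (with_proj (cayley_digraph G S)) w v" if v: "v \<in> carrier G" for v
  proof -
    obtain w g where "w \<in> D" "g \<in> B" "v = w \<otimes> g" using D(2) v unfolding N_def by blast
    moreover from this have "w \<in> carrier G" using D(1) by blast
    ultimately show ?thesis
      by (intro bexI[of _ w]) (auto simp: cop_move_def B_def parcs_cayley_iff)
  qed
  ultimately show thesis using that[OF D(1)] by blast
qed

text \<open>
  The cops fill the window \<open>[0, 2w)\<close> of the circle. Those over \<open>[0, w)\<close> stay put, those over \<open>[w, 2w)\<close>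
  translate by \<open>g\<close> in every round. No arc jumps across \<open>w\<close> consecutive occupied positions, and since
  \<open>t \<le> w\<close> the moving block leaves no gap, so the robber's territory \<open>[2w + jt, e)\<close> shrinks to nothing.
\<close>

lemma (in comm_group) cops_win_sweep:
  fixes \<psi> :: "'a \<Rightarrow> int" and e t :: int and w :: nat
  assumes fin: "finite (carrier G)" and S: "S \<subseteq> carrier G" and e: "0 < e"
    and hom: "\<And>x y. x \<in> carrier G \<Longrightarrow> y \<in> carrier G \<Longrightarrow> [\<psi> (x \<otimes> y) = \<psi> x + \<psi> y] (mod e)"
    and small: "\<And>g. g \<in> S \<Longrightarrow> \<exists>\<delta>. [\<psi> g = \<delta>] (mod e) \<and> \<bar>\<delta>\<bar> \<le> int w"
    and g: "g \<in> S" "[\<psi> g = t] (mod e)" "0 < t" "t \<le> int w"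
  shows "\<exists>k. int k * e \<le> 2 * int w * int (order G) \<and> cops_win (with_proj (cayley_digraph G S)) s k"
proof -
  let ?\<Gamma> = "with_proj (cayley_digraph G S)"
  obtain a where a: "int (card {x \<in> carrier G. (\<psi> x - a) mod e < int (2 * w)}) * e
      \<le> int (2 * w) * int (card (carrier G))"
    using exists_light_window[OF fin e] by blast
  define pos where "pos x = (\<psi> x - a) mod e" for x
  have pos: "0 \<le> pos x" "pos x < e" for x using e by (auto simp: pos_def)
  define C where "C = {x \<in> carrier G. pos x < 2 * int w}"
  have finC: "finite C" using fin by (simp add: C_def)
  obtain k c where k: "k = card C" and c: "bij_betw c {..<k} C"
    using finC bij_betw_from_nat_into_finite by blast
  have cC: "c i \<in> C" if "i < k" for i
    using c that by (auto simp: bij_betw_def)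
  have cs: "c ` {..<k} = C" using c by (rule bij_betw_imp_surj_on)
  have gG: "g \<in> carrier G" using g S by blast
  define \<sigma> where "\<sigma> h i = (if pos (c i) < int w then c i else c i \<otimes> g [^] length h)" for h :: "'a list" and i
  have strat: "cop_strategy ?\<Gamma> k \<sigma>"
    unfolding cop_strategy_def
  proof (intro conjI allI impI)
    fix i assume "i < k"
    then show "\<sigma> [] i \<in> verts ?\<Gamma>"
      using cC[of i] by (auto simp: \<sigma>_def C_def)
  next
    fix h :: "'a list" and v i assume "i < k"
    then have ci: "c i \<in> carrier G" using cC[of i] by (simp add: C_def)
    then have "c i \<otimes> g [^] Suc (length h) = (c i \<otimes> g [^] length h) \<otimes> g"
      using gG by (simp add: m_assoc)
    with ci show "cop_move ?\<Gamma> (\<sigma> h i) (\<sigma> (h @ [v]) i)"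
      using gG g(1) by (auto simp del: nat_pow_Suc simp add: \<sigma>_def cop_move_def parcs_cayley_iff)
  qed
  have fixed: "y \<in> \<sigma> h ` {..<k}" if "y \<in> carrier G" "pos y < int w" for y h
  proof -
    have "y \<in> C" using that pos(1)[of y] by (simp add: C_def)
    then obtain i where "i < k" "c i = y" using cs by blast
    moreover from this that have "\<sigma> h i = y" by (simp add: \<sigma>_def)
    ultimately show ?thesis by (metis imageI lessThan_iff)
  qed
  have moving: "y \<in> \<sigma> h ` {..<k}"
    if y: "y \<in> carrier G" "int w + int (length h) * t \<le> pos y" "pos y < 2 * int w + int (length h) * t" for y h
  proof -
    \<comment> \<open>The cop on \<open>y\<close> is the one that started at \<open>y\<close>
      translated back \<open>L\<close> times. Its starting position is \<open>pos y - L * t\<close>,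
      in the second block; nothing wraps around, since this number lies in [0, e).\<close>
    define L where "L = length h"
    define x where "x = y \<otimes> inv (g [^] L)"
    have x: "x \<in> carrier G" "x \<otimes> g [^] L = y"
      using y gG by (auto simp: x_def m_assoc)
    have "[\<psi> y = \<psi> x + \<psi> (g [^] L)] (mod e)"
      using hom[of x "g [^] L"] x gG by simp
    also have "[\<psi> x + \<psi> (g [^] L) = \<psi> x + int L * \<psi> g] (mod e)"
      using hom_mod_nat_pow[OF subgroup_self hom gG] by (intro cong_add) auto
    also have "[\<psi> x + int L * \<psi> g = \<psi> x + int L * t] (mod e)"
      using g(2) by (intro cong_add cong_mult) auto
    finally have "[\<psi> y - a - int L * t = \<psi> x - a] (mod e)"
      by (simp add: cong_iff_dvd_diff algebra_simps)
    moreover have "[\<psi> y - a - int L * t = pos y - int L * t] (mod e)"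
      unfolding pos_def by (intro cong_diff) auto
    ultimately have "pos x = (pos y - int L * t) mod e"
      unfolding pos_def cong_def by simp
    also have "\<dots> = pos y - int L * t"
    proof (rule mod_pos_pos_trivial)
      show "0 \<le> pos y - int L * t" using y(2) by (simp add: L_def)
      have "0 \<le> int L * t" using g(3) by simp
      then show "pos y - int L * t < e" using pos(2)[of y] by linarith
    qed
    finally have px: "pos x = pos y - int L * t" .
    have "x \<in> C"
      unfolding C_def using px x(1) y(3) by (simp add: L_def)
    then obtain i where "i < k" "c i = x" using cs by blast
    moreover have "\<not> pos (c i) < int w"
      using \<open>c i = x\<close> px y(2) by (simp add: L_def)
    then have "\<sigma> h i = y"
      using \<open>c i = x\<close> x(2) by (simp add: \<sigma>_def L_def)
    ultimately show ?thesis by (metis imageI lessThan_iff)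
  qed
  have "\<not> escapes ?\<Gamma> s k \<sigma> r" for r
  proof
    assume esc: "escapes ?\<Gamma> s k \<sigma> r"
    \<comment> \<open>The cops stand on \<open>X j\<close> after having seen \<open>r 0\<close> to
      \<open>r j\<close>, a history of length \<open>Suc j\<close>; the moving block has then
      advanced by \<open>Suc j * t\<close>.\<close>
    define X where "X j = \<sigma> (map r [0..<Suc j]) ` {..<k}" for j
    have away: "2 * int w + int (Suc j) * t \<le> pos y"
      if "y \<in> carrier G" "y \<notin> X j" "int w + int (Suc j) * t \<le> pos y" for y j
    proof (rule ccontr)
      assume "\<not> ?thesis"
      then have "y \<in> X j"
        unfolding X_def using that(1,3) by (intro moving) (simp_all del: upt_Suc)
      with that(2) show False by contradiction
    qed
    have "\<forall>j. r j \<notin> X j \<and> robber_move ?\<Gamma> s (X j) (r j) (r (Suc j))"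
      using esc unfolding escapes_def X_def Let_def by (elim conjE)
    then have r: "r j \<notin> X j" "robber_move ?\<Gamma> s (X j) (r j) (r (Suc j))" for j
      by simp_all
    have "r j \<in> carrier G \<and> 2 * int w + int j * t \<le> pos (r j)" for j
    proof (induction j)
      case 0
      have "r 0 \<in> verts ?\<Gamma> \<and> r 0 \<notin> \<sigma> [] ` {..<k}"
        using esc unfolding escapes_def by (elim conjE) (intro conjI)
      then have r0: "r 0 \<in> carrier G" "r 0 \<notin> \<sigma> [] ` {..<k}" by simp_all
      have "2 * int w \<le> pos (r 0)"
      proof (rule ccontr)
        assume "\<not> ?thesis"
        then have "r 0 \<in> \<sigma> [] ` {..<k}"
          by (cases "pos (r 0) < int w") (rule fixed moving; simp add: r0(1))+
        with r0(2) show False by contradiction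
      qed
      with r0(1) show ?case by simp
    next
      case (Suc j)
      let ?P = "\<lambda>y. y \<in> carrier G \<and> 2 * int w + int (Suc j) * t \<le> pos y"
      show ?case
      proof (rule robber_move_induct[OF r(2), where P = ?P])
        show "?P (r j)"
        proof -
          \<comment> \<open>As \<open>t\<close> is at most \<open>w\<close>, the rear of the
            advanced block does not pass its former front: the robber cannot end up behind
            it.\<close>
          have "int w + int (Suc j) * t \<le> 2 * int w + int j * t"
            using g(4) by (simp add: algebra_simps)
          with Suc have "int w + int (Suc j) * t \<le> pos (r j)" by linarith
          with Suc away r(1) show ?thesis by blast
        qed
      next
        fix x y assume xy: "x \<rightarrow>\<^bsub>?\<Gamma>\<^esub> y" "?P x" "y \<notin> X j"
        then obtain g' where g': "g' \<in> S" "y = x \<otimes> g'" by (auto simp: parcs_cayley_iff)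
        then have y: "y \<in> carrier G" using S xy by auto
        obtain \<delta> where \<delta>: "[\<psi> g' = \<delta>] (mod e)" "\<bar>\<delta>\<bar> \<le> int w" using small[OF g'(1)] by blast
        have "[\<psi> y = \<psi> x + \<psi> g'] (mod e)" using hom[of x g'] g' xy S by auto
        also have "[\<psi> x + \<psi> g' = \<psi> x + \<delta>] (mod e)" using \<delta>(1) by (intro cong_add) auto
        finally have "[\<psi> y - a = (\<psi> x + \<delta>) - a] (mod e)" by (intro cong_diff) auto
        then have "[\<psi> y - a = (\<psi> x - a) + \<delta>] (mod e)" by (simp add: algebra_simps)
        moreover have "[(\<psi> x - a) + \<delta> = pos x + \<delta>] (mod e)"
          unfolding pos_def by (intro cong_add) auto
        ultimately have py: "pos y = (pos x + \<delta>) mod e"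
          unfolding pos_def cong_def by simp
        have tj: "0 \<le> int (Suc j) * t" using g(3) by simp
        show "?P y"
        \<comment> \<open>Without wrapping, the step goes back by at most \<open>w\<close>, hence
          not behind the moving block, whose positions are occupied. Wrapping past \<open>e\<close>
          leads to a position below \<open>w\<close>, held by the standing block.\<close>
        proof (cases "pos x + \<delta> < e")
          case True
          then have "pos y = pos x + \<delta>"
            unfolding py using xy(2) \<delta>(2) tj by (intro mod_pos_pos_trivial) linarith+
          then have "int w + int (Suc j) * t \<le> pos y" using xy(2) \<delta>(2) by linarith
          with away[OF y xy(3)] y show ?thesis by blast
        next
          case False
          have "pos y = (pos x + \<delta> - e) mod e" unfolding py by simp
          also have "\<dots> = pos x + \<delta> - e"
            using False xy(2) \<delta>(2) tj pos(2)[of x] by (intro mod_pos_pos_trivial) linarith+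
          finally have "pos y < int w" using pos(2)[of x] \<delta>(2) by linarith
          then have "y \<in> X j" unfolding X_def by (rule fixed[OF y])
          with xy(3) show ?thesis by contradiction
        qed
      qed
    qed
    \<comment> \<open>Since \<open>t\<close> is at least 1, after \<open>e\<close> rounds the bound
      has reached the end of the circle.\<close>
    then have "2 * int w + int (nat e) * t \<le> pos (r (nat e))" by blast
    then have "2 * int w + e * t \<le> pos (r (nat e))" using e by simp
    moreover have "e * 1 \<le> e * t" using e g(3) by (intro mult_left_mono) auto
    ultimately show False using pos(2)[of "r (nat e)"] by linarith
  qed
  with strat have "cops_win ?\<Gamma> s k" unfolding cops_win_def by blast
  moreover have "int k * e \<le> 2 * int w * int (order G)"
    using a by (simp add: k C_def pos_def order_def)
  ultimately show ?thesis by blast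
qed

section \<open>Homomorphisms to the integers modulo \<open>n\<close>\<close>

text \<open>
  Characters of \<open>H\<close> that are trivial on \<open>K\<close>, with values in \<open>\<int>/n\<close> represented by \<open>{0..<n}\<close>; they are
  extensional on \<open>H\<close> so that they can be counted.
\<close>

definition mod_homs :: "('a, 'm) monoid_scheme \<Rightarrow> nat \<Rightarrow> 'a set \<Rightarrow> 'a set \<Rightarrow> ('a \<Rightarrow> int) set" where
  "mod_homs G n K H = {f \<in> H \<rightarrow>\<^sub>E {0..<int n}.
     (\<forall>x\<in>H. \<forall>y\<in>H. [f (x \<otimes>\<^bsub>G\<^esub> y) = f x + f y] (mod int n)) \<and> (\<forall>x\<in>K. f x = 0)}"

lemma mod_homsD:
  assumes "f \<in> mod_homs G n K H"
  shows "x \<in> H \<Longrightarrow> y \<in> H \<Longrightarrow> [f (x \<otimes>\<^bsub>G\<^esub> y) = f x + f y] (mod int n)"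
    and "x \<in> K \<Longrightarrow> f x = 0"
    and "x \<in> H \<Longrightarrow> 0 \<le> f x" and "x \<in> H \<Longrightarrow> f x < int n"
    and "f \<in> extensional H"
  using assms by (auto simp: mod_homs_def PiE_iff)

lemma finite_mod_homs: "finite H \<Longrightarrow> finite (mod_homs G n K H)"
  unfolding mod_homs_def by (rule finite_subset[of _ "H \<rightarrow>\<^sub>E {0..<int n}"]) (auto intro: finite_PiE)

section \<open>Extension of characters by one element at a time\<close>

context comm_group
begin

text \<open>For \<open>x\<close> of finite order this is the subgroup generated by \<open>H\<close>
  and \<open>x\<close>; natural exponents are then enough.\<close>

definition adjoin :: "'a set \<Rightarrow> 'a \<Rightarrow> 'a set" where
  "adjoin H x = {h \<otimes> x [^] i | h (i::nat). h \<in> H}"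

lemma adjoin_mult:
  assumes "h \<in> carrier G" "h' \<in> carrier G" "x \<in> carrier G"
  shows "(h \<otimes> x [^] (i::nat)) \<otimes> (h' \<otimes> x [^] (i'::nat)) = (h \<otimes> h') \<otimes> x [^] (i + i')"
  using assms by (simp add: nat_pow_mult[symmetric] m_ac)

lemma subset_adjoin:
  assumes "H \<subseteq> carrier G"
  shows "H \<subseteq> adjoin H x"
proof
  fix h assume "h \<in> H"
  moreover from this assms have "h = h \<otimes> x [^] (0::nat)" by auto
  ultimately show "h \<in> adjoin H x" unfolding adjoin_def by blast
qed

lemma mem_adjoin:
  assumes "subgroup H G" "x \<in> carrier G"
  shows "x \<in> adjoin H x"
proof -
  have "x = \<one> \<otimes> x [^] (1::nat)" using assms(2) by simp
  then show ?thesis unfolding adjoin_def using subgroup.one_closed[OF assms(1)] by blast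
qed

lemma subgroup_adjoin:
  assumes H: "subgroup H G" and x: "x \<in> carrier G" and n: "0 < n" "x [^] (n::nat) = \<one>"
  shows "subgroup (adjoin H x) G"
proof (rule subgroupI)
  note HG = subgroup.mem_carrier[OF H]
  show "adjoin H x \<subseteq> carrier G" using HG x by (auto simp: adjoin_def)
  show "adjoin H x \<noteq> {}" using mem_adjoin[OF H x] by blast
  show "a \<otimes> b \<in> adjoin H x" if ab: "a \<in> adjoin H x" "b \<in> adjoin H x" for a b
  proof -
    obtain h i h' i' where hi: "h \<in> H" "a = h \<otimes> x [^] (i::nat)" "h' \<in> H" "b = h' \<otimes> x [^] (i'::nat)"
      using ab unfolding adjoin_def by blast
    then have "a \<otimes> b = (h \<otimes> h') \<otimes> x [^] (i + i')" using adjoin_mult HG x by simp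
    then show ?thesis unfolding adjoin_def using subgroup.m_closed[OF H] hi by blast
  qed
  show "inv a \<in> adjoin H x" if a: "a \<in> adjoin H x" for a
  proof -
    obtain h i where hi: "h \<in> H" "a = h \<otimes> x [^] (i::nat)"
      using a unfolding adjoin_def by blast
    \<comment> \<open>The exponent \<open>i * (n - 1)\<close> stands for \<open>-i\<close>, because
      the \<open>n\<close>-th power of \<open>x\<close> is the identity.\<close>
    have "x [^] (i + i * (n - 1)) = (x [^] n) [^] i"
    proof -
      have "i + i * (n - 1) = n * i" using n(1) by (cases n) simp_all
      then show ?thesis using x by (simp add: nat_pow_pow)
    qed
    then have "a \<otimes> (inv h \<otimes> x [^] (i * (n - 1))) = \<one>"
      using hi HG x n by (simp add: adjoin_mult)
    then have "inv a = inv h \<otimes> x [^] (i * (n - 1))"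
      using hi HG x by (intro comm_inv_char) auto
    then show ?thesis unfolding adjoin_def using subgroup.m_inv_closed[OF H] hi by blast
  qed
qed

text \<open>\<open>m\<close> is the order of \<open>x\<close> modulo \<open>H\<close>, the least
  positive exponent that leads into \<open>H\<close>; division with remainder shows that it divides
  all others.\<close>

lemma relative_order:
  assumes H: "subgroup H G" and x: "x \<in> carrier G" and n: "0 < n" "x [^] (n::nat) \<in> H"
  obtains m :: nat where "0 < m" and "\<And>k. x [^] k \<in> H \<longleftrightarrow> m dvd k"
proof -
  define m :: nat where "m = (LEAST k. 0 < k \<and> x [^] k \<in> H)"
  have "0 < m \<and> x [^] m \<in> H"
    unfolding m_def by (rule LeastI[of _ n]) (simp add: n)
  then have m: "0 < m" "x [^] m \<in> H" by simp_all
  have least: "k = 0" if "k < m" "x [^] k \<in> H" for k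
    using not_less_Least[OF that(1)[unfolded m_def]] that(2) by simp
  have mult: "x [^] (m * q) \<in> H" for q
    using subgroup_nat_pow_closed[OF H m(2), of q] x by (simp add: nat_pow_pow)
  have "x [^] k \<in> H \<longleftrightarrow> m dvd k" for k
  proof
    assume k: "x [^] k \<in> H"
    have "x [^] k = x [^] (m * (k div m)) \<otimes> x [^] (k mod m)"
      using x by (simp add: nat_pow_mult)
    then have "x [^] (k mod m) = inv (x [^] (m * (k div m))) \<otimes> x [^] k"
      using x by (simp add: m_assoc[symmetric])
    then have "x [^] (k mod m) \<in> H"
      using k mult H by (simp add: subgroup.m_closed subgroup.m_inv_closed)
    then have "k mod m = 0" using m(1) by (intro least) auto
    then show "m dvd k" by (simp add: dvd_eq_mod_eq_0)
  next
    assume "m dvd k"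
    then show "x [^] k \<in> H" using mult by (auto simp: dvd_def)
  qed
  with m(1) that show thesis by blast
qed

text \<open>The extension sends h + i x to f h + i c. All relations between \<open>H\<close> and the
  powers of \<open>x\<close> come from \<open>x [^] m\<close> lying in \<open>H\<close>, so the
  congruence for \<open>c\<close> makes this well defined.\<close>

lemma mod_hom_extend:
  assumes H: "subgroup H G" and K: "subgroup K G" "K \<subseteq> H" and x: "x \<in> carrier G" and n: "0 < n"
    and f: "f \<in> mod_homs G n K H"
    and m: "\<And>k. x [^] (k::nat) \<in> H \<longleftrightarrow> m dvd k"
    and c: "[int m * c = f (x [^] (m::nat))] (mod int n)"
  shows "\<exists>f'\<in>mod_homs G n K (adjoin H x). (\<forall>h\<in>H. f' h = f h) \<and> f' x = c mod int n"
proof -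
  note HG = subgroup.mem_carrier[OF H]
  note hom = mod_homsD(1)[OF f]
  have wd_le: "[f h + int i * c = f h' + int i' * c] (mod int n)"
    if hi: "h \<in> H" "h' \<in> H" "h \<otimes> x [^] i = h' \<otimes> x [^] i'" "i \<le> i'" for h h' and i i' :: nat
  proof -
    define d where "d = i' - i"
    have "h \<otimes> x [^] i = (h' \<otimes> x [^] d) \<otimes> x [^] i"
      using hi HG x by (simp add: m_assoc nat_pow_mult d_def)
    then have h: "h = h' \<otimes> x [^] d" using hi HG x by simp
    then have "x [^] d = inv h' \<otimes> h" using hi HG x by (simp add: m_assoc[symmetric])
    then have xd: "x [^] d \<in> H" using hi H by (simp add: subgroup.m_closed subgroup.m_inv_closed)
    then obtain q where q: "d = m * q" using m by (auto simp: dvd_def)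
    have "[f h = f h' + f (x [^] d)] (mod int n)" unfolding h using hom hi xd by simp
    also have "x [^] d = (x [^] m) [^] q" using x by (simp add: q nat_pow_pow)
    also have "[f h' + f ((x [^] m) [^] q) = f h' + int q * f (x [^] m)] (mod int n)"
      using hom_mod_nat_pow[OF H hom] m[of m] by (intro cong_add) auto
    also have "[f h' + int q * f (x [^] m) = f h' + int q * (int m * c)] (mod int n)"
      using c by (intro cong_add cong_mult) (auto intro: cong_sym)
    finally have "[f h + int i * c = f h' + int q * (int m * c) + int i * c] (mod int n)"
      by (intro cong_add) auto
    also have "f h' + int q * (int m * c) + int i * c = f h' + (int d + int i) * c"
      by (simp add: q algebra_simps)
    also have "int d + int i = int i'" using hi(4) by (simp add: d_def)
    finally show ?thesis .
  qed
  have wd: "[f h + int i * c = f h' + int i' * c] (mod int n)"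
    if "h \<in> H" "h' \<in> H" "h \<otimes> x [^] i = h' \<otimes> x [^] i'" for h h' and i i' :: nat
    using wd_le[of h h' i i'] wd_le[of h' h i' i] that by (cases "i \<le> i'") (auto intro: cong_sym)
  define rep where "rep y = (SOME p. fst p \<in> H \<and> y = fst p \<otimes> x [^] (snd p :: nat))" for y
  define f' where "f' = restrict (\<lambda>y. (f (fst (rep y)) + int (snd (rep y)) * c) mod int n) (adjoin H x)"
  have f': "f' (h \<otimes> x [^] i) = (f h + int i * c) mod int n" if h: "h \<in> H" for h and i :: nat
  proof -
    let ?y = "h \<otimes> x [^] i"
    have "fst (rep ?y) \<in> H \<and> ?y = fst (rep ?y) \<otimes> x [^] snd (rep ?y)"
      unfolding rep_def by (rule someI[of _ "(h, i)"]) (simp add: h)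
    then have "[f (fst (rep ?y)) + int (snd (rep ?y)) * c = f h + int i * c] (mod int n)"
      using wd[of "fst (rep ?y)" h "snd (rep ?y)" i] h by metis
    moreover have "?y \<in> adjoin H x" unfolding adjoin_def using h by blast
    ultimately show ?thesis by (simp add: f'_def cong_def)
  qed
  \<comment> \<open>The values of \<open>f\<close> already lie in \<open>{0..<n}\<close>, so
    reduction modulo \<open>n\<close> leaves them alone.\<close>
  have on_H: "f' h = f h" if h: "h \<in> H" for h
    using f'[OF h, of 0] h HG mod_homsD(3,4)[OF f h] by simp
  have "f \<one> = 0" using mod_homsD(2)[OF f] subgroup.one_closed[OF K(1)] by blast
  then have "f' x = c mod int n"
    using f'[OF subgroup.one_closed[OF H], of 1] x by simp
  moreover have "f' \<in> mod_homs G n K (adjoin H x)"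
    unfolding mod_homs_def
  proof (intro CollectI conjI ballI)
    show "f' \<in> adjoin H x \<rightarrow>\<^sub>E {0..<int n}"
      using n by (auto simp: f'_def)
    show "f' y = 0" if "y \<in> K" for y
      using on_H that K(2) mod_homsD(2)[OF f] by auto
    show "[f' (a \<otimes> b) = f' a + f' b] (mod int n)" if ab: "a \<in> adjoin H x" "b \<in> adjoin H x" for a b
    proof -
      obtain h i h' i' where hi: "h \<in> H" "a = h \<otimes> x [^] (i::nat)" "h' \<in> H" "b = h' \<otimes> x [^] (i'::nat)"
        using ab unfolding adjoin_def by blast
      then have "a \<otimes> b = (h \<otimes> h') \<otimes> x [^] (i + i')" using adjoin_mult HG x by simp
      then have "f' (a \<otimes> b) = (f (h \<otimes> h') + int (i + i') * c) mod int n"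
        using f' subgroup.m_closed[OF H] hi by simp
      then have "[f' (a \<otimes> b) = f (h \<otimes> h') + int (i + i') * c] (mod int n)" by simp
      also have "[f (h \<otimes> h') + int (i + i') * c = (f h + f h') + int (i + i') * c] (mod int n)"
        using hom hi by (intro cong_add) auto
      also have "(f h + f h') + int (i + i') * c = (f h + int i * c) + (f h' + int i' * c)"
        by (simp add: algebra_simps)
      also have "[\<dots> = f' a + f' b] (mod int n)"
        using f' hi by (intro cong_add) (simp_all add: cong_sym)
      finally show ?thesis .
    qed
  qed
  ultimately show ?thesis using on_H by blast
qed

text \<open>With \<open>m\<close> the order of \<open>x\<close> modulo \<open>H\<close>, exponents
  can be taken below \<open>m\<close>, and each character of \<open>H\<close> has at least
  \<open>m\<close> extensions, one for each admissible value at \<open>x\<close>.\<close>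

lemma card_mod_homs_adjoin:
  assumes fin: "finite (carrier G)" and H: "subgroup H G" and K: "subgroup K G" "K \<subseteq> H"
    and x: "x \<in> carrier G" and n: "0 < n" "x [^] (n::nat) = \<one>"
  obtains m where "card (adjoin H x) \<le> m * card H"
    and "m * card (mod_homs G n K H) \<le> card (mod_homs G n K (adjoin H x))"
proof -
  note HG = subgroup.mem_carrier[OF H]
  have finH: "finite H" by (rule finite_subset[OF subgroup.subset[OF H] fin])
  have xn: "x [^] n \<in> H" using n(2) subgroup.one_closed[OF H] by simp
  obtain m :: nat where m: "0 < m" "\<And>k. x [^] k \<in> H \<longleftrightarrow> m dvd k"
    using relative_order[OF H x n(1) xn] by blast
  have "m dvd n" using m(2) xn by blast
  then obtain q where q: "n = m * q" by (auto simp: dvd_def)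
  have "adjoin H x \<subseteq> (\<lambda>(h, i). h \<otimes> x [^] i) ` (H \<times> {..<m})"
  proof
    fix y assume "y \<in> adjoin H x"
    then obtain h i where hi: "h \<in> H" "y = h \<otimes> x [^] (i::nat)" unfolding adjoin_def by blast
    have "x [^] i = x [^] (m * (i div m)) \<otimes> x [^] (i mod m)" using x by (simp add: nat_pow_mult)
    then have "y = (h \<otimes> x [^] (m * (i div m))) \<otimes> x [^] (i mod m)"
      using hi HG x by (simp add: m_assoc)
    moreover have "h \<otimes> x [^] (m * (i div m)) \<in> H"
      using hi m(2) subgroup.m_closed[OF H] by simp
    ultimately show "y \<in> (\<lambda>(h, i). h \<otimes> x [^] i) ` (H \<times> {..<m})"
      using m(1) by (intro image_eqI[of _ _ "(h \<otimes> x [^] (m * (i div m)), i mod m)"]) auto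
  qed
  then have "card (adjoin H x) \<le> card (H \<times> {..<m})"
    using finH by (intro surj_card_le) auto
  then have 1: "card (adjoin H x) \<le> m * card H" by (simp add: card_cartesian_product mult.commute)
  \<comment> \<open>the \<open>m\<close> solutions of \<open>m c = f (x^m)\<close> modulo \<open>n\<close>; the division is exact since \<open>q f (x^m) = f (x^n) = 0\<close>\<close>
  define c where "c f j = f (x [^] m) div int m + int q * int j" for f :: "'a \<Rightarrow> int" and j :: nat
  have "\<exists>f'\<in>mod_homs G n K (adjoin H x). (\<forall>h\<in>H. f' h = f h) \<and> f' x = c f j mod int n"
    if f: "f \<in> mod_homs G n K H" for f j
  proof (rule mod_hom_extend[OF H K x n(1) f m(2)])
    have xm: "x [^] m \<in> H" using m(2) by simp
    have "[f ((x [^] m) [^] q) = int q * f (x [^] m)] (mod int n)"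
      by (rule hom_mod_nat_pow[OF H mod_homsD(1)[OF f] xm])
    also have "(x [^] m) [^] q = \<one>" using x n(2) by (simp add: nat_pow_pow q)
    also have "f \<one> = 0" using mod_homsD(2)[OF f] subgroup.one_closed[OF K(1)] by blast
    finally have "int n dvd int q * f (x [^] m)" using cong_0_iff cong_sym by blast
    then have "int m dvd f (x [^] m)" using n(1) by (simp add: q mult.commute)
    then have "int m * c f j = f (x [^] m) + int n * int j" by (simp add: c_def q algebra_simps)
    then show "[int m * c f j = f (x [^] m)] (mod int n)" by (simp add: cong_iff_dvd_diff)
  qed
  then obtain F where F: "\<And>f j. f \<in> mod_homs G n K H \<Longrightarrow> F f j \<in> mod_homs G n K (adjoin H x)"
    "\<And>f j h. f \<in> mod_homs G n K H \<Longrightarrow> h \<in> H \<Longrightarrow> F f j h = f h"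
    "\<And>f j. f \<in> mod_homs G n K H \<Longrightarrow> F f j x = c f j mod int n"
    by metis
  \<comment> \<open>Restriction to \<open>H\<close> recovers \<open>f\<close>; the value at
    \<open>x\<close> then determines \<open>q * j\<close> modulo \<open>n = m * q\<close>, hence
    \<open>j\<close>.\<close>
  have "inj_on (\<lambda>(f, j). F f j) (mod_homs G n K H \<times> {..<m})"
  proof (rule inj_onI, clarify)
    fix f f' and j j' :: nat
    assume f: "f \<in> mod_homs G n K H" "f' \<in> mod_homs G n K H" and j: "j < m" "j' < m"
      and eq: "F f j = F f' j'"
    have ff: "f = f'"
    proof (rule extensionalityI[OF mod_homsD(5)[OF f(1)] mod_homsD(5)[OF f(2)]])
      show "f h = f' h" if "h \<in> H" for h using F(2)[OF f(1) that] F(2)[OF f(2) that] eq by metis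
    qed
    have "c f j mod int n = c f' j' mod int n" using F(3)[OF f(1)] F(3)[OF f(2)] eq by metis
    then have "int n dvd int q * (int j - int j')"
      by (simp add: mod_eq_dvd_iff c_def ff algebra_simps)
    then have "int m dvd int j - int j'" using n(1) by (simp add: q mult.commute)
    then have "[int j = int j'] (mod int m)" by (simp add: cong_iff_dvd_diff)
    then have "j = j'" using j by (simp add: cong_def)
    with ff show "f = f' \<and> j = j'" by simp
  qed
  moreover have "finite (mod_homs G n K (adjoin H x))"
    using fin HG x by (intro finite_mod_homs finite_subset[OF _ fin]) (auto simp: adjoin_def)
  ultimately have "card (mod_homs G n K H \<times> {..<m}) \<le> card (mod_homs G n K (adjoin H x))"
    using F(1) by (intro card_inj_on_le[of "\<lambda>(f, j). F f j"]) auto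
  with 1 that[of m] show thesis by (simp add: card_cartesian_product mult.commute)
qed

text \<open>The lower bound in the duality of finite abelian groups. Climbing from \<open>K\<close>
  to the whole group by adjoining elements, each step multiplies the number of characters by at
  least the growth of the subgroup.\<close>

lemma card_mod_homs:
  assumes fin: "finite (carrier G)" and K: "subgroup K G"
    and n: "0 < n" "\<And>x. x \<in> carrier G \<Longrightarrow> x [^] (n::nat) = \<one>"
  shows "order G \<le> card K * card (mod_homs G n K (carrier G))"
proof -
  have step: "card (carrier G) \<le> card K * card (mod_homs G n K (carrier G))"
    if "subgroup H G" "K \<subseteq> H" "card H \<le> card K * card (mod_homs G n K H)" for H
    using that
  proof (induction "card (carrier G - H)" arbitrary: H rule: less_induct)
    case less
    have HG: "H \<subseteq> carrier G" using less.prems(1) by (rule subgroup.subset)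
    show ?case
    proof (cases "H = carrier G")
      case True
      with less.prems(3) show ?thesis by simp
    next
      case False
      with HG obtain x where x: "x \<in> carrier G" "x \<notin> H" by blast
      let ?H' = "adjoin H x"
      have sub: "subgroup ?H' G" using subgroup_adjoin[OF less.prems(1) x(1) n(1)] n(2) x by blast
      have HH': "H \<subseteq> ?H'" "x \<in> ?H'"
        using subset_adjoin[OF HG] mem_adjoin[OF less.prems(1) x(1)] by auto
      obtain m where m: "card ?H' \<le> m * card H"
        "m * card (mod_homs G n K H) \<le> card (mod_homs G n K ?H')"
        using card_mod_homs_adjoin[OF fin less.prems(1) K less.prems(2) x(1) n(1) n(2)[OF x(1)]] by blast
      have "card ?H' \<le> m * (card K * card (mod_homs G n K H))"
        using m(1) less.prems(3) by (meson le_trans mult_le_mono2)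
      also have "\<dots> = card K * (m * card (mod_homs G n K H))" by simp
      also have "\<dots> \<le> card K * card (mod_homs G n K ?H')" using m(2) by (rule mult_le_mono2)
      finally have "card ?H' \<le> card K * card (mod_homs G n K ?H')" .
      moreover have "card (carrier G - ?H') < card (carrier G - H)"
        using fin HH' x by (intro psubset_card_mono) auto
      ultimately show ?thesis using less.hyps[of ?H'] sub less.prems(2) HH' by blast
    qed
  qed
  have finK: "finite K" by (rule finite_subset[OF subgroup.subset[OF K] fin])
  have "restrict (\<lambda>_. 0) K \<in> mod_homs G n K K"
    using n(1) subgroup.m_closed[OF K] by (auto simp: mod_homs_def)
  then have "card (mod_homs G n K K) > 0"
    using finite_mod_homs[OF finK] by (auto simp: card_gt_0_iff)
  then have "card K \<le> card K * card (mod_homs G n K K)" by (cases "card (mod_homs G n K K)") auto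
  then show ?thesis using step[OF K] by (simp add: order_def)
qed

end

section \<open>The bound from a proper subgroup\<close>

lemma abs_diff_less_of_div_eq:
  fixes a b m :: int
  assumes "0 < m" and "a div m = b div m"
  shows "\<bar>a - b\<bar> < m"
proof -
  have "a = m * (a div m) + a mod m" by simp
  moreover have "b = m * (a div m) + b mod m" unfolding assms(2) by simp
  moreover have "0 \<le> a mod m" "a mod m < m" "0 \<le> b mod m" "b mod m < m"
    using assms(1) by simp_all
  ultimately show ?thesis by linarith
qed

context comm_group
begin

text \<open>
  Dirichlet's argument: there are at least \<open>[G : K]\<close> characters trivial on \<open>K\<close>, hence two of them agree up
  to less than \<open>n / N\<close> on a representative of every direction, and \<open>f\<close> is their difference.
\<close>

lemma exists_small_mod_hom:
  assumes fin: "finite (carrier G)" and S: "S \<subseteq> carrier G" and K: "subgroup K G"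
    and n: "0 < n" "\<And>x. x \<in> carrier G \<Longrightarrow> x [^] (n::nat) = \<one>"
    and N: "0 < N" "N ^ num_directions G S K * card K < order G"
  obtains f where "\<And>x y. x \<in> carrier G \<Longrightarrow> y \<in> carrier G \<Longrightarrow> [f (x \<otimes> y) = f x + f y] (mod int n)"
    and "\<exists>x\<in>carrier G. \<not> [f x = 0] (mod int n)"
    and "\<And>g. g \<in> S \<Longrightarrow> \<exists>\<delta>. [f g = \<delta>] (mod int n) \<and> \<bar>\<delta>\<bar> * int N < int n"
proof -
  interpret K: normal K G using K by (rule subgroup_imp_normal)
  let ?M = "mod_homs G n K (carrier G)"
  \<comment> \<open>Writing the inverse in the quotient as the coset of \<open>inv g\<close> lets
    \<open>f\<close> be evaluated on both members of a direction.\<close>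
  define dir where "dir g = {K #> g, K #> inv g}" for g
  define D where "D = {dir g | g. g \<in> S \<and> K #> g \<noteq> K}"
  have "{{K #> g, inv\<^bsub>G Mod K\<^esub> (K #> g)} | g. g \<in> S \<and> K #> g \<noteq> \<one>\<^bsub>G Mod K\<^esub>} = D"
  proof -
    have "inv\<^bsub>G Mod K\<^esub> (K #> g) = K #> inv g" if "g \<in> S" for g
      using that S by (subst K.inv_FactGroup) (auto simp: carrier_FactGroup K.rcos_inv)
    then show ?thesis unfolding D_def dir_def by (auto; metis)
  qed
  then have r: "num_directions G S K = card D" by (simp add: num_directions_def)
  have finS: "finite S" by (rule finite_subset[OF S fin])
  have finD: "finite D"
    by (rule finite_subset[of _ "dir ` S"]) (use finS in \<open>auto simp: D_def\<close>)
  have "\<forall>P\<in>D. \<exists>g. g \<in> S \<and> P = dir g" unfolding D_def by blast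
  then obtain rep where rep: "\<And>P. P \<in> D \<Longrightarrow> rep P \<in> S" "\<And>P. P \<in> D \<Longrightarrow> P = dir (rep P)"
    by metis
  \<comment> \<open>For each direction, \<open>box f\<close> tells which of the \<open>N\<close>
    intervals of length n/N contains the value at the chosen generator. There are at most N^r boxes,
    fewer than characters.\<close>
  define box where "box f = restrict (\<lambda>P. int N * f (rep P) div int n) D" for f :: "'a \<Rightarrow> int"
  have "box ` ?M \<subseteq> D \<rightarrow>\<^sub>E {0..<int N}"
  proof (intro image_subsetI PiE_I)
    fix f P assume f: "f \<in> ?M" and P: "P \<in> D"
    have g: "rep P \<in> carrier G" using rep(1)[OF P] S by blast
    have "int N * f (rep P) < int N * int n"
      using mod_homsD(4)[OF f g] N(1) by simp
    moreover have "int N * f (rep P) div int n * int n + int N * f (rep P) mod int n = int N * f (rep P)"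
      by (rule div_mult_mod_eq)
    moreover have "0 \<le> int N * f (rep P) mod int n" using n(1) by simp
    ultimately have "int N * f (rep P) div int n * int n < int N * int n" by linarith
    then have "int N * f (rep P) div int n < int N" by (rule mult_right_less_imp_less) simp
    moreover have "0 \<le> int N * f (rep P) div int n"
      using mod_homsD(3)[OF f g] n(1) by (simp add: pos_imp_zdiv_nonneg_iff)
    ultimately show "box f P \<in> {0..<int N}" using P by (simp add: box_def)
  qed (simp add: box_def)
  then have "card (box ` ?M) \<le> N ^ card D"
    using card_mono[of "D \<rightarrow>\<^sub>E {0..<int N}" "box ` ?M"] finD by (simp add: card_funcsetE finite_PiE)
  also have "\<dots> < card ?M"
  proof -
    have "N ^ card D * card K < card ?M * card K"
      using less_le_trans[OF N(2) card_mod_homs[OF fin K n]] by (simp only: r mult.commute)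
    then show ?thesis by (rule mult_right_less_imp_less) simp
  qed
  finally have "\<not> inj_on box ?M" by (rule pigeonhole)
  then obtain f1 f2 where f: "f1 \<in> ?M" "f2 \<in> ?M" "f1 \<noteq> f2" "box f1 = box f2"
    unfolding inj_on_def by blast
  define f where "f x = f1 x - f2 x" for x
  have hom: "[f (x \<otimes> y) = f x + f y] (mod int n)" if "x \<in> carrier G" "y \<in> carrier G" for x y
  proof -
    have "[f1 (x \<otimes> y) - f2 (x \<otimes> y) = (f1 x + f1 y) - (f2 x + f2 y)] (mod int n)"
      by (intro cong_diff mod_homsD(1)[OF f(1)] mod_homsD(1)[OF f(2)] that)
    then show ?thesis by (simp add: f_def algebra_simps)
  qed
  have f_K: "f x = 0" if "x \<in> K" for x
    using mod_homsD(2)[OF f(1) that] mod_homsD(2)[OF f(2) that] by (simp add: f_def)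
  have "\<exists>x\<in>carrier G. f1 x \<noteq> f2 x"
    using f(3) extensionalityI[OF mod_homsD(5)[OF f(1)] mod_homsD(5)[OF f(2)]] by blast
  then obtain x where x: "x \<in> carrier G" "f1 x \<noteq> f2 x" by blast
  have "\<not> [f1 x = f2 x] (mod int n)"
    using x mod_homsD(3,4)[OF f(1) x(1)] mod_homsD(3,4)[OF f(2) x(1)] by (simp add: cong_def)
  then have nontriv: "\<not> [f x = 0] (mod int n)" by (simp add: f_def cong_iff_dvd_diff)
  have coset: "[f a = f b] (mod int n)"
    if ab: "a \<in> carrier G" "b \<in> carrier G" "K #> a = K #> b" for a b
  proof -
    have "a \<in> K #> b" using rcos_self[OF ab(1) K] ab(3) by simp
    then obtain k where k: "k \<in> K" "a = k \<otimes> b" unfolding r_coset_def by blast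
    then have "[f a = f k + f b] (mod int n)" using hom[of k b] ab K.mem_carrier by simp
    then show ?thesis using f_K[OF k(1)] by simp
  qed
  have f_inv: "[f (inv a) = - f a] (mod int n)" if a: "a \<in> carrier G" for a
  proof -
    have "[f \<one> = f (inv a) + f a] (mod int n)" using hom[of "inv a" a] a by simp
    then have "[0 = f (inv a) + f a] (mod int n)" using f_K[OF K.one_closed] by simp
    then have "[f (inv a) + f a = - f a + f a] (mod int n)" by (simp add: cong_sym)
    then show ?thesis by (simp only: cong_add_rcancel)
  qed
  have "\<exists>\<delta>. [f g = \<delta>] (mod int n) \<and> \<bar>\<delta>\<bar> * int N < int n" if g: "g \<in> S" for g
  proof (cases "K #> g = K")
    case True
    have "g \<in> K" using coset_join1[OF True] g S K by blast
    then have "f g = 0" by (rule f_K)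
    then show ?thesis using n(1) by (intro exI[of _ 0]) simp
  next
    case False
    define h where "h = rep (dir g)"
    have D: "dir g \<in> D" using False g unfolding D_def by blast
    have hS: "h \<in> S" using rep(1)[OF D] by (simp add: h_def)
    have gc: "g \<in> carrier G" and hc: "h \<in> carrier G" using g hS S by auto
    \<comment> \<open>The coset of \<open>g\<close> is that of \<open>h\<close> or of its inverse,
      so \<open>f g\<close> is \<open>f h\<close> up to sign modulo \<open>n\<close>: the bound at
      the representative serves the whole direction.\<close>
    have "K #> g \<in> dir h" using rep(2)[OF D] by (auto simp: h_def dir_def)
    then have "[f g = f h] (mod int n) \<or> [f g = f (inv h)] (mod int n)"
      using coset[OF gc hc] coset[OF gc, of "inv h"] hc by (auto simp: dir_def)
    then have pm: "[f g = f h] (mod int n) \<or> [f g = - f h] (mod int n)"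
      using f_inv[OF hc] cong_trans by blast
    have "int N * f1 h div int n = int N * f2 h div int n"
      using fun_cong[OF f(4), of "dir g"] D by (simp add: box_def h_def)
    then have "\<bar>int N * f1 h - int N * f2 h\<bar> < int n"
      using n(1) by (intro abs_diff_less_of_div_eq) simp_all
    also have "int N * f1 h - int N * f2 h = f h * int N" by (simp add: f_def algebra_simps)
    finally have "\<bar>f h\<bar> * int N < int n" by (simp add: abs_mult)
    with pm show ?thesis by (metis abs_minus_cancel)
  qed
  with hom nontriv x(1) that[of f] show thesis by blast
qed

text \<open>A walk from the identity writes every element as a sum of generators. Read
  contrapositively, a nontrivial homomorphism moves some generator, the one that drives the
  sweep.\<close>

lemma mod_hom_trivial_of_strongly_connected:
  assumes conn: "strongly_connected (with_proj (cayley_digraph G S))" and S: "S \<subseteq> carrier G"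
    and hom: "\<And>x y. x \<in> carrier G \<Longrightarrow> y \<in> carrier G \<Longrightarrow> [f (x \<otimes> y) = f x + f y] (mod (e::int))"
    and triv: "\<And>g. g \<in> S \<Longrightarrow> [f g = 0] (mod e)"
    and x: "x \<in> carrier G"
  shows "[f x = 0] (mod e)"
proof -
  have "(\<one>, x) \<in> rtrancl_on (carrier G) (parcs (cayley_digraph G S))"
    using conn x unfolding strongly_connected_def reachable_def by simp
  then have "(\<one>, x) \<in> (parcs (cayley_digraph G S))\<^sup>*" by (rule rtrancl_on_rtranclI)
  then show ?thesis
  proof (induction rule: rtrancl_induct)
    case base
    have "[0 + f \<one> = f \<one> + f \<one>] (mod e)" using hom[of \<one> \<one>] by simp
    then show ?case unfolding cong_add_rcancel by (rule cong_sym)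
  next
    case (step y z)
    then obtain g where g: "y \<in> carrier G" "g \<in> S" "z = y \<otimes> g" by (auto simp: parcs_cayley_iff)
    have "[f z = f y + f g] (mod e)" using hom[of y g] g S by auto
    also have "[f y + f g = 0 + 0] (mod e)" using step.IH triv[OF g(2)] by (rule cong_add)
    finally show ?case by simp
  qed
qed

lemma cop_number_le_quotient:
  assumes fin: "finite (carrier G)" and S: "S \<subseteq> carrier G"
    and conn: "strongly_connected (with_proj (cayley_digraph G S))"
    and K: "subgroup K G"
    and N: "0 < N" "N ^ num_directions G S K * card K < order G"
  shows "N * cop_number (with_proj (cayley_digraph G S)) s \<le> 2 * order G"
proof -
  let ?\<Gamma> = "with_proj (cayley_digraph G S)"
  define n where "n = order G"
  have n: "0 < n" "\<And>x. x \<in> carrier G \<Longrightarrow> x [^] n = \<one>"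
    using order_gt_0_iff_finite fin pow_order_eq_1 by (auto simp: n_def)
  obtain f where hom: "\<And>x y. x \<in> carrier G \<Longrightarrow> y \<in> carrier G \<Longrightarrow> [f (x \<otimes> y) = f x + f y] (mod int n)"
    and nontriv: "\<exists>x\<in>carrier G. \<not> [f x = 0] (mod int n)"
    and small: "\<And>g. g \<in> S \<Longrightarrow> \<exists>\<delta>. [f g = \<delta>] (mod int n) \<and> \<bar>\<delta>\<bar> * int N < int n"
    using exists_small_mod_hom[OF fin S K n N] by metis
  obtain g where g: "g \<in> S" "\<not> [f g = 0] (mod int n)"
    using mod_hom_trivial_of_strongly_connected[OF conn S hom] nontriv by blast
  obtain \<delta> where \<delta>: "[f g = \<delta>] (mod int n)" "\<bar>\<delta>\<bar> * int N < int n" using small[OF g(1)] by blast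
  have "\<delta> \<noteq> 0" using g(2) \<delta>(1) by blast
  \<comment> \<open>The largest integer with w N < n, which therefore bounds every step
    length.\<close>
  define w where "w = (n - 1) div N"
  have w: "\<bar>\<epsilon>\<bar> \<le> int w" if "\<bar>\<epsilon>\<bar> * int N < int n" for \<epsilon>
  proof -
    have "int (nat \<bar>\<epsilon>\<bar> * N) < int n" using that by simp
    then have "nat \<bar>\<epsilon>\<bar> * N < n" by (simp only: of_nat_less_iff)
    then have "nat \<bar>\<epsilon>\<bar> * N \<le> n - 1" by simp
    then have "nat \<bar>\<epsilon>\<bar> \<le> w" unfolding w_def using N(1) by (simp add: less_eq_div_iff_mult_less_eq)
    then show ?thesis by linarith
  qed
  \<comment> \<open>If the chosen generator moves backwards, the circle is reflected, since the
    sweep needs a positive step.\<close>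
  define \<sigma> where "\<sigma> = sgn \<delta>"
  have \<sigma>: "\<bar>\<sigma>\<bar> = 1" "\<sigma> * \<delta> = \<bar>\<delta>\<bar>" using \<open>\<delta> \<noteq> 0\<close> by (auto simp: \<sigma>_def sgn_if)
  have "\<exists>k. int k * int n \<le> 2 * int w * int (order G) \<and> cops_win ?\<Gamma> s k"
  proof (rule cops_win_sweep[where \<psi> = "\<lambda>x. \<sigma> * f x" and t = "\<bar>\<delta>\<bar>" and g = g])
    show "[\<sigma> * f (x \<otimes> y) = \<sigma> * f x + \<sigma> * f y] (mod int n)"
      if "x \<in> carrier G" "y \<in> carrier G" for x y
      using cong_scalar_left[OF hom[OF that], of \<sigma>] by (simp add: distrib_left)
    show "\<exists>\<epsilon>. [\<sigma> * f h = \<epsilon>] (mod int n) \<and> \<bar>\<epsilon>\<bar> \<le> int w" if h: "h \<in> S" for h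
    proof -
      obtain \<epsilon> where \<epsilon>: "[f h = \<epsilon>] (mod int n)" "\<bar>\<epsilon>\<bar> * int N < int n" using small[OF h] by blast
      have "[\<sigma> * f h = \<sigma> * \<epsilon>] (mod int n)" using \<epsilon>(1) by (rule cong_scalar_left)
      moreover have "\<bar>\<sigma> * \<epsilon>\<bar> \<le> int w" using w[OF \<epsilon>(2)] \<sigma>(1) by (simp add: abs_mult)
      ultimately show ?thesis by blast
    qed
    show "[\<sigma> * f g = \<bar>\<delta>\<bar>] (mod int n)"
      using cong_scalar_left[OF \<delta>(1), of \<sigma>] \<sigma>(2) by simp
    show "\<bar>\<delta>\<bar> \<le> int w" using \<delta>(2) by (rule w)
  qed (use fin S g n \<open>\<delta> \<noteq> 0\<close> in auto)
  then obtain k where k: "int k * int n \<le> 2 * int w * int n" "cops_win ?\<Gamma> s k"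
    by (auto simp: n_def)
  have "int k \<le> int (2 * w)" using k(1) n(1) by simp
  then have "k \<le> 2 * w" by linarith
  then have "cop_number ?\<Gamma> s \<le> 2 * w" using cop_number_le[OF k(2)] by simp
  then have "N * cop_number ?\<Gamma> s \<le> 2 * (N * w)" by (metis mult.left_commute mult_le_mono2)
  also have "N * w \<le> n" unfolding w_def by (metis diff_le_self le_trans times_div_less_eq_dividend)
  finally show ?thesis by (simp add: n_def)
qed

end

text \<open>Raising the real root to the power r recovers |G/K| - 1, so its floor satisfies an
  inequality between integers. The root is at least 1 because its base is.\<close>

lemma root_index_pow_le:
  assumes "2 \<le> order (G Mod K)"
  shows "0 < root_index G S K"
    and "root_index G S K ^ num_directions G S K \<le> order (G Mod K) - 1"
proof -
  define b where "b = order (G Mod K) - 1"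
  define r where "r = num_directions G S K"
  have b: "1 \<le> b" "real (order (G Mod K)) - 1 = real b" using assms by (auto simp: b_def)
  have N: "root_index G S K = nat \<lfloor>real b powr (1 / real r)\<rfloor>"
    by (simp add: root_index_def b(2) r_def)
  have "1 \<le> real b powr (1 / real r)" using b(1) by (intro ge_one_powr_ge_zero) auto
  then show "0 < root_index G S K" unfolding N by linarith
  show "root_index G S K ^ num_directions G S K \<le> order (G Mod K) - 1"
  proof (cases "r = 0")
    case True
    then show ?thesis using b(1) by (simp add: r_def b_def)
  next
    case False
    have "real (root_index G S K) \<le> real b powr (1 / real r)" unfolding N by simp
    then have "real (root_index G S K) ^ r \<le> (real b powr (1 / real r)) ^ r"
      by (intro power_mono) auto
    also have "\<dots> = real b"
      using False b(1) by (simp add: powr_realpow[symmetric] powr_powr)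
    finally show ?thesis by (simp add: r_def b_def flip: of_nat_power)
  qed
qed

section \<open>Combination of the two bounds\<close>

theorem theorem1p2:
  fixes G :: "('a, 'm) monoid_scheme" and S :: "'a set" and s :: nat
  defines "\<Gamma> \<equiv> with_proj (cayley_digraph G S)"
    and "n \<equiv> order G"
    and "d \<equiv> card S"
  assumes "comm_group G"
    and "finite (carrier G)"
    and "n \<ge> 2"
    and "S \<subseteq> carrier G - {\<one>\<^bsub>G\<^esub>}"
    and "strongly_connected \<Gamma>"
    and "s \<ge> 1"
  shows "cop_number \<Gamma> (enat s) \<le> cop_number \<Gamma> \<infinity> \<and>
    real (cop_number \<Gamma> \<infinity>) \<le>
      min (real n * (1 + ln (real d + 1)) / (real d + 1))
          (2 * real n / real (max_root_index G S))"
proof -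
  interpret comm_group G by fact
  note fin = \<open>finite (carrier G)\<close>
  have S: "S \<subseteq> carrier G" using assms(7) by blast
  obtain D where D: "D \<subseteq> carrier G" "\<And>v. v \<in> carrier G \<Longrightarrow> \<exists>w\<in>D. cop_move \<Gamma> w v"
    "real (d + 1) * real (card D) \<le> real n * (1 + ln (real (d + 1)))"
    using exists_dominating_set[OF fin assms(7)] unfolding \<Gamma>_def n_def d_def by blast
  have finD: "finite D" by (rule finite_subset[OF D(1) fin])
  have win: "cops_win \<Gamma> \<infinity> (card D)"
    using D(1,2) by (intro cops_win_dominating finD) (simp_all add: \<Gamma>_def)
  \<comment> \<open>Some number of cops wins, so the least such number is attained and can be used
    against the slower robber.\<close>
  then have "cops_win \<Gamma> \<infinity> (cop_number \<Gamma> \<infinity>)" unfolding cop_number_def by (rule LeastI)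
  then have "cops_win \<Gamma> (enat s) (cop_number \<Gamma> \<infinity>)" by (rule cops_win_antimono_speed) simp
  then have 1: "cop_number \<Gamma> (enat s) \<le> cop_number \<Gamma> \<infinity>" by (rule cop_number_le)
  have "real (d + 1) * real (cop_number \<Gamma> \<infinity>) \<le> real (d + 1) * real (card D)"
    using cop_number_le[OF win] by (intro mult_left_mono) auto
  with D(3) have "real (d + 1) * real (cop_number \<Gamma> \<infinity>) \<le> real n * (1 + ln (real (d + 1)))"
    by linarith
  then have 2: "real (cop_number \<Gamma> \<infinity>) \<le> real n * (1 + ln (real d + 1)) / (real d + 1)"
    by (simp add: pos_le_divide_eq algebra_simps)
  let ?R = "{root_index G S K | K. subgroup K G \<and> K \<subset> carrier G}"
  have "?R \<subseteq> root_index G S ` Pow (carrier G)" by blast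
  then have "finite ?R" by (rule finite_subset) (simp add: fin)
  \<comment> \<open>Order at least 2 makes the trivial subgroup proper, so the maximum is taken over
    a nonempty set and is attained at some \<open>K\<close>.\<close>
  moreover have "{\<one>\<^bsub>G\<^esub>} \<subset> carrier G"
  proof -
    have "{\<one>\<^bsub>G\<^esub>} \<noteq> carrier G"
    proof
      assume "{\<one>\<^bsub>G\<^esub>} = carrier G"
      then have "card (carrier G) = 1" by (metis card.empty card.insert empty_iff finite.emptyI One_nat_def)
      then show False using \<open>n \<ge> 2\<close> by (simp add: n_def order_def)
    qed
    then show ?thesis by blast
  qed
  then have "root_index G S {\<one>\<^bsub>G\<^esub>} \<in> ?R" using triv_subgroup by blast
  ultimately have "max_root_index G S \<in> ?R" unfolding max_root_index_def by (intro Max_in) auto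
  then obtain K where K: "max_root_index G S = root_index G S K" "subgroup K G" "K \<subset> carrier G"
    by blast
  define N where "N = root_index G S K"
  have ord: "order (G Mod K) * card K = order G"
    using lagrange[OF K(2)] by (simp add: order_def FactGroup_def)
  have "card K < order G" unfolding order_def using fin K(3) by (rule psubset_card_mono)
  with ord have "order (G Mod K) \<noteq> 0 \<and> order (G Mod K) \<noteq> 1"
    by (metis less_irrefl mult_1 mult_zero_left not_less_zero)
  then have M: "2 \<le> order (G Mod K)" by linarith
  have cK: "0 < card K" using ord \<open>n \<ge> 2\<close> by (cases "card K") (auto simp: n_def)
  have N0: "0 < N" unfolding N_def using root_index_pow_le(1)[OF M] .
  \<comment> \<open>The subtracted 1 in N_K yields the strict inequality that the pigeonhole
    principle calls for.\<close>
  have "N ^ num_directions G S K < order (G Mod K)"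
    using root_index_pow_le(2)[OF M, of S] M unfolding N_def by linarith
  then have "N ^ num_directions G S K * card K < order G"
    using cK unfolding ord[symmetric] by simp
  then have "N * cop_number \<Gamma> \<infinity> \<le> 2 * n"
    unfolding \<Gamma>_def n_def
    using cop_number_le_quotient[OF fin S _ K(2) N0] assms(8) by (simp add: \<Gamma>_def)
  then have "real N * real (cop_number \<Gamma> \<infinity>) \<le> 2 * real n"
    by (metis of_nat_le_iff of_nat_mult of_nat_numeral)
  then have "real (cop_number \<Gamma> \<infinity>) \<le> 2 * real n / real (max_root_index G S)"
    using N0 K(1) by (simp add: N_def pos_le_divide_eq mult.commute)
  with 1 2 show ?thesis by simp
qed

end
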